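(* Let $G$ be a graph, $B$ a standard zero forcing set of $G$, and $\mathcal F$ a relaxed chronology of standard forces for $B$. Then (1) $\operatorname{Term}(\mathcal F)$ is a standard zero forcing set of $G$, (2) $\operatorname{Rev}(\mathcal F)$ is a relaxed chronology of standard forces for $\operatorname{Term}(\mathcal F)$, and (3) $\operatorname{pt}(G,\operatorname{Rev}(\mathcal F))=\operatorname{pt}(G,\mathcal F)$.
   Context: All graphs are finite, simple and undirected. Standard zero forcing: each vertex is blue or white; a blue vertex $u$ with exactly one white neighbor $v$ can force $v$ to become blue (written $u\to v$). A set $B$ of vertices is a standard zero forcing set of $G$ if, starting with exactly $B$ blue, repeated forcing turns all vertices blue. $S(G,B)$ denotes the set of forces valid in $G$ when exactly the vertices of $B$ are blue. Relaxed chronology of standard forces for a standard zero forcing set $B$: an ordered family $\mathcal F=\{F^{(k)}\}_{k=1}^K$ of sets of forces ($F^{(k)}=\emptyset$ allowed) such that, with $E^{[0]}=E^{(0)}=B$, $E^{(k)}=\{u: v\to u\in F^{(k)}\text{ for some }v\}$ and $E^{[k]}=\bigcup_{j=0}^kE^{(j)}$ for $k=1,\dots,K$: (a) $F^{(k)}\subseteq S(G,E^{[k-1]})$ for $k=1,\dots,K$; (b) $v_1\to u,\ v_2\to u\in F^{(k)}$ implies $v_1=v_2$; (c) $E^{[K]}=V(G)$. $\operatorname{Term}(\mathcal F)$, the terminus of $\mathcal F$, is the set of vertices of $G$ that perform no force in $\mathcal F$. $\operatorname{Rev}(\mathcal F)$, the reversal of $\mathcal F$, is $\{F_{\operatorname{Rev}}^{(k)}\}_{k=1}^K$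 with $F_{\operatorname{Rev}}^{(k)}=\{v\to u: u\to v\in F^{(K-k+1)}\}$. The propagation time $\operatorname{pt}(G,\mathcal F)$ is defined from the underlying set of forces $F=\bigcup_kF^{(k)}$ and the initial set $B$: put $D^{(0)}=B$, and for $t\ge0$ let $D^{(t+1)}$ be the set of vertices $w$ such that $v\to w\in F\cap S(G,\bigcup_{i=0}^tD^{(i)})$ for some $v$; then $\operatorname{pt}(G,\mathcal F)$ is the least $t_0$ with $\bigcup_{t=0}^{t_0}D^{(t)}=V(G)$. For $\operatorname{Rev}(\mathcal F)$ the initial set is $\operatorname{Term}(\mathcal F)$. *)

theory Defs
  imports "Graph_Theory.Pair_Digraph"
begin

text \<open>
  A finite simple undirected graph is a \<^locale>\<open>pair_graph\<close>: finitely many vertices, and an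
  irreflexive symmetric set \<^term>\<open>parcs G\<close> of ordered pairs, each edge occurring in both
  orientations. A force $u \to v$ is the pair \<^term>\<open>(u, v)\<close>.
\<close>

definition valid_forces :: "'a pair_pre_digraph \<Rightarrow> 'a set \<Rightarrow> ('a \<times> 'a) set" where
  "valid_forces G B =
     {(u, v). u \<in> pverts G \<and> u \<in> B \<and> {w. (u, w) \<in> parcs G \<and> w \<notin> B} = {v}}"

definition force_step :: "'a pair_pre_digraph \<Rightarrow> 'a set \<Rightarrow> 'a set \<Rightarrow> bool" where
  "force_step G A A' \<longleftrightarrow> (\<exists>u v. (u, v) \<in> valid_forces G A \<and> A' = insert v A)"

definition zero_forcing_set :: "'a pair_pre_digraph \<Rightarrow> 'a set \<Rightarrow> bool" where
  "zero_forcing_set G B \<longleftrightarrow> B \<subseteq> pverts G \<and> (force_step G)\<^sup>*\<^sup>* B (pverts G)"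

text \<open>
  An ordered family $\{F^{(k)}\}_{k=1}^K$ is a list \<open>Fs\<close> of length $K$. Lists are indexed from
  0, so $F^{(k)}$ is \<open>Fs ! (k - 1)\<close>. The next two definitions are $E^{(k)}$ and $E^{[k]}$.
\<close>

definition newly_blue :: "'a set \<Rightarrow> ('a \<times> 'a) set list \<Rightarrow> nat \<Rightarrow> 'a set" where
  "newly_blue B Fs k = (if k = 0 then B else {u. \<exists>v. (v, u) \<in> Fs ! (k - 1)})"

definition blue_after :: "'a set \<Rightarrow> ('a \<times> 'a) set list \<Rightarrow> nat \<Rightarrow> 'a set" where
  "blue_after B Fs k = (\<Union>j\<le>k. newly_blue B Fs j)"

definition relaxed_chronology ::
    "'a pair_pre_digraph \<Rightarrow> 'a set \<Rightarrow> ('a \<times> 'a) set list \<Rightarrow> bool" where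
  "relaxed_chronology G B Fs \<longleftrightarrow>
     (\<forall>k\<in>{1..length Fs}. Fs ! (k - 1) \<subseteq> valid_forces G (blue_after B Fs (k - 1))) \<and>
     (\<forall>k\<in>{1..length Fs}. \<forall>v\<^sub>1 v\<^sub>2 u.
        (v\<^sub>1, u) \<in> Fs ! (k - 1) \<and> (v\<^sub>2, u) \<in> Fs ! (k - 1) \<longrightarrow> v\<^sub>1 = v\<^sub>2) \<and>
     blue_after B Fs (length Fs) = pverts G"

definition terminus :: "'a pair_pre_digraph \<Rightarrow> ('a \<times> 'a) set list \<Rightarrow> 'a set" where
  "terminus G Fs = {v \<in> pverts G. \<forall>F\<in>set Fs. \<forall>w. (v, w) \<notin> F}"

definition reversal :: "('a \<times> 'a) set list \<Rightarrow> ('a \<times> 'a) set list" where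
  "reversal Fs = rev (map converse Fs)"

text \<open>
  \<open>prop_layer G B F t\<close> is $D^{(t)}$ for the underlying set of forces $F$.
\<close>

fun prop_layer ::
    "'a pair_pre_digraph \<Rightarrow> 'a set \<Rightarrow> ('a \<times> 'a) set \<Rightarrow> nat \<Rightarrow> 'a set" where
  "prop_layer G B F 0 = B"
| "prop_layer G B F (Suc t) =
     {w. \<exists>v. (v, w) \<in> F \<inter> valid_forces G (\<Union>i\<in>{..t}. prop_layer G B F i)}"

text \<open>
  The initial set \<open>B\<close>, implicit in the notation $\mathrm{pt}(G, \mathcal F)$, is an explicit
  argument.
\<close>

definition prop_time ::
    "'a pair_pre_digraph \<Rightarrow> 'a set \<Rightarrow> ('a \<times> 'a) set list \<Rightarrow> nat" where
  "prop_time G B Fs = (LEAST t\<^sub>0. (\<Union>t\<le>t\<^sub>0. prop_layer G B (\<Union>(set Fs)) t) = pverts G)"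

text \<open>
  For a relaxed chronology the minimum defining \<^const>\<open>prop_time\<close> is over a nonempty set.
\<close>

lemma blue_after_Suc:
  "blue_after B Fs (Suc k) = blue_after B Fs k \<union> {u. \<exists>v. (v, u) \<in> Fs ! k}"
  by (auto simp: blue_after_def newly_blue_def atMost_Suc)

lemma prop_time_exists:
  assumes "pair_graph G" "zero_forcing_set G B" "relaxed_chronology G B Fs"
  shows "\<exists>t\<^sub>0. (\<Union>t\<le>t\<^sub>0. prop_layer G B (\<Union>(set Fs)) t) = pverts G"
proof -
  define F where "F = \<Union>(set Fs)"
  define D where "D = (\<lambda>k. \<Union>t\<le>k. prop_layer G B F t)"
  have D_Suc: "D (Suc k) = D k \<union> {w. \<exists>v. (v, w) \<in> F \<inter> valid_forces G (D k)}" for k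
    by (auto simp: D_def atMost_Suc)
  have valid: "Fs ! k \<subseteq> valid_forces G (blue_after B Fs k)" if "k < length Fs" for k
    using assms(3) that unfolding relaxed_chronology_def
    by (metis Suc_eq_plus1 Suc_leI add_diff_cancel_right' atLeastAtMost_iff le_add2)
  have "blue_after B Fs k \<subseteq> D k" if "k \<le> length Fs" for k
    using that
  proof (induction k)
    case 0
    show ?case by (simp add: blue_after_def newly_blue_def D_def)
  next
    case (Suc k)
    then have IH: "blue_after B Fs k \<subseteq> D k" and k: "k < length Fs" by auto
    have "u \<in> D (Suc k)" if "(v, u) \<in> Fs ! k" for u v
    proof (cases "u \<in> D k")
      case True
      then show ?thesis by (simp add: D_Suc)
    next
      case False
      have "(v, u) \<in> valid_forces G (blue_after B Fs k)" using valid[OF k] that by blast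
      then have "(v, u) \<in> valid_forces G (D k)"
        using IH False unfolding valid_forces_def by blast
      moreover have "(v, u) \<in> F" using that k unfolding F_def by (auto intro: nth_mem)
      ultimately show ?thesis by (auto simp: D_Suc)
    qed
    moreover have "D k \<subseteq> D (Suc k)" by (auto simp: D_Suc)
    ultimately show ?case using IH by (auto simp: blue_after_Suc)
  qed
  then have "pverts G \<subseteq> D (length Fs)"
    using assms(3) unfolding relaxed_chronology_def by (metis order_refl)
  moreover have "D k \<subseteq> pverts G" for k
  proof (induction k)
    case 0
    show ?case using assms(2) by (simp add: D_def zero_forcing_set_def)
  next
    case (Suc k)
    interpret pair_graph G by (rule assms(1))
    have "w \<in> pverts G" if "(v, w) \<in> valid_forces G (D k)" for v w
      using that in_arcsD2 unfolding valid_forces_def by blast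
    then show ?case using Suc by (auto simp: D_Suc)
  qed
  ultimately show ?thesis unfolding D_def F_def by blast
qed

end

theory Submission
  imports Defs
begin

text \<open>
  Within a chronology each vertex forces at most once and is forced at most once, so the forces
  form disjoint chains. Reversed, the blue vertices are those whose force has been undone; a
  white neighbour of \<open>v\<close> other than the vertex \<open>u\<close> that forced \<open>v\<close> would have
  forced before \<open>v\<close> was blue, and so would have had to force \<open>v\<close> itself.
  For the propagation time, the layers of $\mathcal F$ form a chronology of length
  $\mathrm{pt}(G, \mathcal F)$ with the same forces; reversing it gives
  $\mathrm{pt}(G, \mathrm{Rev}(\mathcal F)) \le \mathrm{pt}(G, \mathcal F)$, and reversal is an
  involution.
\<close>

section \<open>Forces, blue sets and reversed lists\<close>

lemma valid_forcesD:
  assumes "(u, v) \<in> valid_forces G A"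
  shows "u \<in> pverts G" "u \<in> A" "(u, v) \<in> parcs G" "v \<notin> A"
    "\<And>w. (u, w) \<in> parcs G \<Longrightarrow> w \<noteq> v \<Longrightarrow> w \<in> A"
  using assms unfolding valid_forces_def by blast+

lemma valid_forces_mono:
  assumes "(u, v) \<in> valid_forces G A" "A \<subseteq> A'" "v \<notin> A'"
  shows "(u, v) \<in> valid_forces G A'"
  using assms unfolding valid_forces_def by blast

lemma blue_after_0: "blue_after B Fs 0 = B"
  by (simp add: blue_after_def newly_blue_def)

lemma blue_after_mono: "i \<le> j \<Longrightarrow> blue_after B Fs i \<subseteq> blue_after B Fs j"
  by (fastforce simp: blue_after_def)

lemma blue_after_conv:
  "blue_after B Fs k = B \<union> {u. \<exists>j<k. \<exists>v. (v, u) \<in> Fs ! j}"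
  by (induction k) (auto simp: blue_after_0 blue_after_Suc less_Suc_eq)

text \<open>Moves the index range from 1..K to list positions 0..K-1, so that the forces at position
  \<open>k\<close> act on \<open>blue_after B Fs k\<close>.\<close>

lemma relaxed_chronology_iff:
  "relaxed_chronology G B Fs \<longleftrightarrow>
     (\<forall>k<length Fs. Fs ! k \<subseteq> valid_forces G (blue_after B Fs k)) \<and>
     (\<forall>k<length Fs. \<forall>v v' u. (v, u) \<in> Fs ! k \<longrightarrow> (v', u) \<in> Fs ! k \<longrightarrow> v = v') \<and>
     blue_after B Fs (length Fs) = pverts G"
proof -
  have "(\<forall>k\<in>{1..length Fs}. P (k - 1)) \<longleftrightarrow> (\<forall>k<length Fs. P k)" for P
  proof -
    have "{1..length Fs} = Suc ` {..<length Fs}"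
      by (simp add: image_Suc_lessThan)
    then show ?thesis by auto
  qed
  note this[of "\<lambda>k. Fs ! k \<subseteq> valid_forces G (blue_after B Fs k)"]
    this[of "\<lambda>k. \<forall>v v' u. (v, u) \<in> Fs ! k \<longrightarrow> (v', u) \<in> Fs ! k \<longrightarrow> v = v'"]
  then show ?thesis
    by (simp only: relaxed_chronology_def imp_conjL)
qed

lemma Union_set_conv_nth: "p \<in> \<Union>(set Fs) \<longleftrightarrow> (\<exists>k<length Fs. p \<in> Fs ! k)"
  by (auto simp: in_set_conv_nth intro: nth_mem)

lemma length_reversal: "length (reversal Fs) = length Fs"
  by (simp add: reversal_def)

lemma nth_reversal: "k < length Fs \<Longrightarrow> reversal Fs ! k = (Fs ! (length Fs - Suc k))\<inverse>"
  by (simp add: reversal_def rev_nth)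

lemma Union_reversal: "\<Union>(set (reversal Fs)) = (\<Union>(set Fs))\<inverse>"
  by (auto simp: reversal_def)

lemma reversal_reversal: "reversal (reversal Fs) = Fs"
  by (simp add: reversal_def rev_map o_def)

lemma terminus_conv: "terminus G Fs = {v \<in> pverts G. \<forall>w. (v, w) \<notin> \<Union>(set Fs)}"
  by (auto simp: terminus_def)

text \<open>Everything proved here is instantiated again, for the reversal and for the chronology
  made of propagation layers.\<close>

locale chronology = pair_graph G for G :: "'a pair_pre_digraph" +
  fixes B :: "'a set" and Fs :: "('a \<times> 'a) set list"
  assumes chron: "relaxed_chronology G B Fs"
begin

section \<open>Forcing chains\<close>

lemma valid: "k < length Fs \<Longrightarrow> p \<in> Fs ! k \<Longrightarrow> p \<in> valid_forces G (blue_after B Fs k)"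
  using chron by (auto simp: relaxed_chronology_iff)

lemma blue_final: "blue_after B Fs (length Fs) = pverts G"
  using chron by (simp add: relaxed_chronology_iff)

lemma blue_subset: "k \<le> length Fs \<Longrightarrow> blue_after B Fs k \<subseteq> pverts G"
  using blue_after_mono blue_final by metis

lemma initial_subset: "B \<subseteq> pverts G"
  using blue_subset[of 0] by (simp add: blue_after_0)

lemma blue_if_forced:
  assumes "(v, u) \<in> Fs ! j" "j < k" shows "u \<in> blue_after B Fs k"
  using assms by (auto simp: blue_after_conv)

text \<open>A target is white when forced and blue ever after, so both forces share a step. There
  condition (b) identifies the forcers.\<close>

lemma forced_once:
  assumes "j < length Fs" "(v, u) \<in> Fs ! j" "k < length Fs" "(v', u) \<in> Fs ! k"
  shows "j = k" "v = v'"
proof -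
  show jk: "j = k"
    using assms valid valid_forcesD(4) blue_if_forced by (metis linorder_neqE_nat)
  show "v = v'"
    using assms chron unfolding jk relaxed_chronology_iff by blast
qed

text \<open>When \<open>v\<close> forces \<open>u\<close>, all other neighbours of \<open>v\<close>
  are blue, and \<open>u\<close> is blue from the next step on. So \<open>v\<close> has no white
  neighbour left to force later.\<close>

lemma forces_once:
  assumes "j < length Fs" "(v, u) \<in> Fs ! j" "k < length Fs" "(v, u') \<in> Fs ! k"
  shows "j = k" "u = u'"
proof -
  have not_less: "\<not> j < k"
    if "j < length Fs" "(v, u) \<in> Fs ! j" "k < length Fs" "(v, u') \<in> Fs ! k" for j k u u'
  proof
    assume less: "j < k"
    have *: "(v, u) \<in> valid_forces G (blue_after B Fs j)"
      "(v, u') \<in> valid_forces G (blue_after B Fs k)"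
      using that valid by auto
    have "u' \<notin> blue_after B Fs j"
      using valid_forcesD(4)[OF *(2)] blue_after_mono[of j k B Fs] less by auto
    then have "u' = u"
      using valid_forcesD(3)[OF *(2)] valid_forcesD(5)[OF *(1)] by blast
    then show False
      using valid_forcesD(4)[OF *(2)] blue_if_forced[OF that(2) less] by simp
  qed
  show jk: "j = k"
    using not_less[OF assms] not_less[OF assms(3,4,1,2)] by simp
  show "u = u'"
    using valid[OF assms(1,2)] valid[OF assms(3,4)] unfolding jk valid_forces_def by blast
qed

lemma forced_iff: "(\<exists>v. (v, u) \<in> \<Union>(set Fs)) \<longleftrightarrow> u \<in> pverts G - B"
proof
  assume "\<exists>v. (v, u) \<in> \<Union>(set Fs)"
  then obtain v k where k: "k < length Fs" "(v, u) \<in> Fs ! k"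
    unfolding Union_set_conv_nth by blast
  have "u \<notin> B"
    using valid_forcesD(4)[OF valid[OF k]] by (simp add: blue_after_conv)
  moreover have "u \<in> pverts G"
    using blue_if_forced[OF k(2,1)] blue_final by simp
  ultimately show "u \<in> pverts G - B" by simp
next
  assume "u \<in> pverts G - B"
  then show "\<exists>v. (v, u) \<in> \<Union>(set Fs)"
    unfolding blue_final[symmetric] Union_set_conv_nth blue_after_conv by blast
qed

section \<open>Reversal and zero forcing\<close>

lemma terminus_reversal: "terminus G (reversal Fs) = B"
proof -
  have "u \<in> terminus G (reversal Fs) \<longleftrightarrow>
      u \<in> pverts G \<and> \<not> (\<exists>v. (v, u) \<in> \<Union>(set Fs))" for u
    unfolding terminus_conv Union_reversal by simp
  then show ?thesis
    unfolding forced_iff using initial_subset by blast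
qed

text \<open>The first \<open>k\<close> reversed steps turn blue exactly the vertices that force in
  the last \<open>k\<close> original steps. By \<open>forces_once\<close> these perform no earlier
  force, which gives the complement form.\<close>

lemma blue_after_reversal:
  assumes "k \<le> length Fs"
  shows "blue_after (terminus G Fs) (reversal Fs) k =
    pverts G - {v. \<exists>j < length Fs - k. \<exists>w. (v, w) \<in> Fs ! j}" (is "?L = ?R")
proof -
  have L: "v \<in> ?L \<longleftrightarrow> v \<in> terminus G Fs \<or> (\<exists>j<length Fs. length Fs - k \<le> j \<and> (\<exists>w. (v, w) \<in> Fs ! j))"
    (is "_ \<longleftrightarrow> _ \<or> ?P") for v
  proof -
    have "(\<exists>j<k. \<exists>w. (w, v) \<in> reversal Fs ! j) \<longleftrightarrow> ?P"
    proof
      assume "\<exists>j<k. \<exists>w. (w, v) \<in> reversal Fs ! j"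
      then obtain j w where "j < k" "(v, w) \<in> Fs ! (length Fs - Suc j)"
        using assms by (auto simp: nth_reversal)
      then show ?P
        using assms by (intro exI[of _ "length Fs - Suc j"]) auto
    next
      assume ?P
      then obtain j w where "j < length Fs" "length Fs - k \<le> j" "(v, w) \<in> Fs ! j" by blast
      then show "\<exists>j<k. \<exists>w. (w, v) \<in> reversal Fs ! j"
        using assms by (intro exI[of _ "length Fs - Suc j"]) (auto simp: nth_reversal)
    qed
    then show ?thesis by (auto simp: blue_after_conv)
  qed
  have T: "v \<in> terminus G Fs \<longleftrightarrow> v \<in> pverts G \<and> \<not> (\<exists>j<length Fs. \<exists>w. (v, w) \<in> Fs ! j)" for v
    unfolding terminus_conv Union_set_conv_nth by blast
  have V: "v \<in> pverts G" if "j < length Fs" "(v, w) \<in> Fs ! j" for v w j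
    using valid_forcesD(1) valid that by metis
  show ?thesis
  proof (intro set_eqI iffI)
    fix v assume "v \<in> ?L"
    then consider "v \<in> terminus G Fs"
      | j w where "j < length Fs" "length Fs - k \<le> j" "(v, w) \<in> Fs ! j"
      unfolding L by blast
    then show "v \<in> ?R"
    proof cases
      case 1
      then show ?thesis unfolding T by auto
    next
      case 2
      have "\<not> i < length Fs - k" if "(v, w') \<in> Fs ! i" for i w'
        using forces_once(1)[OF 2(1,3) _ that] 2(2) by fastforce
      then show ?thesis using V 2 by blast
    qed
  next
    fix v assume "v \<in> ?R"
    then show "v \<in> ?L"
      unfolding L T by (metis (mono_tags, lifting) DiffE linorder_not_le mem_Collect_eq)
  qed
qed

lemma relaxed_chronology_reversal: "relaxed_chronology G (terminus G Fs) (reversal Fs)"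
  unfolding relaxed_chronology_iff length_reversal
proof (intro conjI allI impI)
  show "blue_after (terminus G Fs) (reversal Fs) (length Fs) = pverts G"
    by (simp add: blue_after_reversal)
next
  fix k v v' u
  assume "k < length Fs" "(v, u) \<in> reversal Fs ! k" "(v', u) \<in> reversal Fs ! k"
  then show "v = v'"
    using forces_once(2)[of "length Fs - Suc k" u v "length Fs - Suc k" v']
    by (simp add: nth_reversal)
next
  fix k assume k: "k < length Fs"
  \<comment> \<open>The reversed step \<open>k\<close> undoes the forces at position
    \<open>m\<close>; the white vertices are then those that force at a position up to
    \<open>m\<close>.\<close>
  define m where "m = length Fs - Suc k"
  have m: "m < length Fs" "length Fs - k = Suc m" using k by (auto simp: m_def)
  have "(v, u) \<in> valid_forces G (blue_after (terminus G Fs) (reversal Fs) k)" (is "_ \<in> valid_forces G ?A")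
    if vu: "(u, v) \<in> Fs ! m" for u v
  proof -
    have A: "?A = pverts G - {v. \<exists>j\<le>m. \<exists>w. (v, w) \<in> Fs ! j}"
      using blue_after_reversal[of k] k m(2) by (simp add: less_Suc_eq_le)
    note uv = valid_forcesD[OF valid[OF m(1) vu]]
    have v_white: "v \<notin> blue_after B Fs j" if "j \<le> m" for j
      using blue_after_mono[OF that, of B Fs] uv(4) by blast
    have arcs: "(v, u) \<in> parcs G" using uv(3) by (rule arcs_symmetric)
    \<comment> \<open>A vertex forcing at a position up to \<open>m\<close> would be blue there, but
      \<open>v\<close> is still white.\<close>
    have v_A: "v \<in> ?A"
    proof -
      have "(v, w) \<notin> Fs ! j" if "j \<le> m" for j w
        using valid_forcesD(2) valid v_white that m(1) by (metis le_less_trans)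
      moreover have "v \<in> pverts G" using arcs by (rule in_arcsD1)
      ultimately show ?thesis unfolding A by blast
    qed
    have "w = u" if w: "(v, w) \<in> parcs G" "w \<notin> ?A" for w
    proof -
      have "w \<in> pverts G" using w(1) by (rule in_arcsD2)
      with w(2) obtain j x where j: "j \<le> m" "(w, x) \<in> Fs ! j" unfolding A by blast
      have j_len: "j < length Fs" using j m by simp
      \<comment> \<open>When \<open>w\<close> forces \<open>x\<close>, its neighbour
        \<open>v\<close> is white, so \<open>v\<close> is the target. The forcer of \<open>v\<close>
        being unique, \<open>w\<close> is \<open>u\<close>.\<close>
      have "v = x"
        using valid_forcesD(5)[OF valid[OF j_len j(2)] arcs_symmetric[OF w(1)]] v_white[OF j(1)]
        by blast
      then show ?thesis
        using forced_once(2)[OF j_len j(2) m(1)] vu by simp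
    qed
    moreover have "u \<notin> ?A" using vu unfolding A by blast
    ultimately show ?thesis
      using arcs v_A in_arcsD1 unfolding valid_forces_def by blast
  qed
  then show "reversal Fs ! k \<subseteq> valid_forces G (blue_after (terminus G Fs) (reversal Fs) k)"
    using k by (auto simp: nth_reversal m_def)
qed

lemma chronology_reversal: "chronology G (terminus G Fs) (reversal Fs)"
  using relaxed_chronology_reversal by unfold_locales

text \<open>Applied to the reversal, this makes the terminus a zero forcing set.\<close>

lemma zero_forcing_set_initial: "zero_forcing_set G B"
proof -
  \<comment> \<open>Simultaneous forces can be made one at a time: each stays valid as the blue set
    grows, until its target is blue.\<close>
  have steps: "(force_step G)\<^sup>*\<^sup>* A (A \<union> X)"
    if "finite X" "\<forall>u\<in>X. \<exists>v. (v, u) \<in> valid_forces G A" for A X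
    using that
  proof (induction X)
    case empty
    show ?case by simp
  next
    case (insert u X)
    obtain v where "(v, u) \<in> valid_forces G A" using insert.prems by blast
    then have "(v, u) \<in> valid_forces G (A \<union> X)"
      using valid_forces_mono valid_forcesD(4) insert.hyps(2) by (metis Un_iff Un_upper1)
    then have "force_step G (A \<union> X) (A \<union> insert u X)"
      unfolding force_step_def by auto
    then show ?case using insert by (meson insertCI rtranclp.rtrancl_into_rtrancl)
  qed
  have "(force_step G)\<^sup>*\<^sup>* B (blue_after B Fs k)" if "k \<le> length Fs" for k
    using that
  proof (induction k)
    case 0
    show ?case by (simp add: blue_after_0)
  next
    case (Suc k)
    let ?X = "{u. \<exists>v. (v, u) \<in> Fs ! k}"
    have "?X \<subseteq> pverts G" using blue_subset[OF Suc.prems] by (auto simp: blue_after_Suc)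
    then have "finite ?X" using pair_finite_verts finite_subset by blast
    moreover have "\<forall>u\<in>?X. \<exists>v. (v, u) \<in> valid_forces G (blue_after B Fs k)"
      using valid[of k] Suc.prems by auto
    ultimately have "(force_step G)\<^sup>*\<^sup>* (blue_after B Fs k) (blue_after B Fs (Suc k))"
      unfolding blue_after_Suc by (rule steps)
    then show ?case using Suc by simp
  qed
  then show ?thesis
    using initial_subset blue_final unfolding zero_forcing_set_def by (metis order_refl)
qed

section \<open>Propagation time\<close>

definition reached :: "nat \<Rightarrow> 'a set" where
  "reached k = (\<Union>t\<le>k. prop_layer G B (\<Union>(set Fs)) t)"

lemma reached_0: "reached 0 = B"
  by (simp add: reached_def)

lemma reached_Suc:
  "reached (Suc k) = reached k \<union> {w. \<exists>v. (v, w) \<in> \<Union>(set Fs) \<inter> valid_forces G (reached k)}"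
  by (auto simp: reached_def atMost_Suc)

lemma reached_subset: "reached k \<subseteq> pverts G"
proof (induction k)
  case 0
  show ?case using initial_subset by (simp add: reached_0)
next
  case (Suc k)
  then show ?case using forced_iff unfolding reached_Suc by blast
qed

text \<open>Making each force as early as possible never lags behind the chronology: a force valid
  on a smaller blue set is still valid on \<open>reached k\<close> unless its target is already
  there.\<close>

lemma blue_subset_reached: "k \<le> length Fs \<Longrightarrow> blue_after B Fs k \<subseteq> reached k"
proof (induction k)
  case 0
  show ?case by (simp add: blue_after_0 reached_0)
next
  case (Suc k)
  then have IH: "blue_after B Fs k \<subseteq> reached k" and k: "k < length Fs" by auto
  have "u \<in> reached (Suc k)" if "(v, u) \<in> Fs ! k" for u v
  proof (cases "u \<in> reached k")
    case False
    then have "(v, u) \<in> valid_forces G (reached k)"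
      using valid_forces_mono[OF valid[OF k that] IH] by simp
    moreover have "(v, u) \<in> \<Union>(set Fs)" using that k by (auto intro: nth_mem)
    ultimately show ?thesis unfolding reached_Suc by blast
  qed (simp add: reached_Suc)
  then show ?case using IH by (auto simp: blue_after_Suc reached_Suc)
qed

lemma reached_length: "reached (length Fs) = pverts G"
  using blue_subset_reached[of "length Fs"] reached_subset blue_final by blast

lemma prop_time_conv: "prop_time G B Fs = (LEAST t. reached t = pverts G)"
  by (simp add: prop_time_def reached_def)

lemma prop_time_le_length: "prop_time G B Fs \<le> length Fs"
  unfolding prop_time_conv using reached_length by (rule Least_le)

lemma reached_prop_time: "reached (prop_time G B Fs) = pverts G"
  unfolding prop_time_conv using reached_length by (rule LeastI)

lemma ex_chronology_length_prop_time:
  obtains Fs' where "chronology G B Fs'" "\<Union>(set Fs') = \<Union>(set Fs)"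
    "length Fs' = prop_time G B Fs"
proof
  let ?F = "\<Union>(set Fs)" and ?T = "prop_time G B Fs"
  \<comment> \<open>Step \<open>t\<close> makes every available force at once, so the blue sets of
    this list are the sets \<open>reached t\<close>.\<close>
  let ?Fs = "map (\<lambda>t. ?F \<inter> valid_forces G (reached t)) [0..<?T]"
  have unique: "v = v'" if "(v, u) \<in> ?F" "(v', u) \<in> ?F" for v v' u
    using that unfolding Union_set_conv_nth by (elim exE conjE) (rule forced_once(2))
  have blue: "blue_after B ?Fs k = reached k" if "k \<le> ?T" for k
    using that by (induction k) (auto simp: blue_after_0 reached_0 blue_after_Suc reached_Suc)
  show "length ?Fs = ?T" by simp
  show "chronology G B ?Fs"
  proof
    show "relaxed_chronology G B ?Fs"
      unfolding relaxed_chronology_iff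
    proof (intro conjI allI impI)
      fix k v v' u
      assume "k < length ?Fs" "(v, u) \<in> ?Fs ! k" "(v', u) \<in> ?Fs ! k"
      then show "v = v'" using unique[of v u v'] by simp
    qed (use blue reached_prop_time in auto)
  qed
  show "\<Union>(set ?Fs) = ?F"
  proof
    show "?F \<subseteq> \<Union>(set ?Fs)"
    proof
      fix p assume p: "p \<in> ?F"
      obtain v u where vu: "p = (v, u)" by (cases p)
      have "u \<in> pverts G" "u \<notin> B" using forced_iff p vu by blast+
      then have "u \<in> blue_after B ?Fs ?T" "u \<notin> B"
        using blue[of ?T] reached_prop_time by simp_all
      \<comment> \<open>The new list forces every vertex outside \<open>B\<close>; as its forces
        come from \<open>?F\<close>, uniqueness of the forcer recovers \<open>p\<close>
        itself.\<close>
      then obtain v' where v': "(v', u) \<in> \<Union>(set ?Fs)"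
        unfolding blue_after_conv Union_set_conv_nth length_map length_upt diff_zero by blast
      then have "v' = v" using unique p vu by auto
      then show "p \<in> \<Union>(set ?Fs)" using v' vu by simp
    qed
  qed auto
qed

lemma prop_time_reversal_le: "prop_time G (terminus G Fs) (reversal Fs) \<le> prop_time G B Fs"
proof -
  obtain Fs' where Fs': "chronology G B Fs'" "\<Union>(set Fs') = \<Union>(set Fs)"
    "length Fs' = prop_time G B Fs"
    by (rule ex_chronology_length_prop_time)
  \<comment> \<open>Terminus and propagation time see only the union of the forces, so the short
    chronology \<open>Fs'\<close> may replace \<open>Fs\<close>.\<close>
  have "prop_time G (terminus G Fs) (reversal Fs) = prop_time G (terminus G Fs') (reversal Fs')"
    by (simp only: prop_time_def terminus_conv Union_reversal Fs'(2))
  also have "\<dots> \<le> length Fs'"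
    using chronology.prop_time_le_length[OF chronology.chronology_reversal[OF Fs'(1)]]
    by (simp add: length_reversal)
  finally show ?thesis by (simp add: Fs'(3))
qed

end

theorem lemma4p3:
  fixes G :: "'a pair_pre_digraph" and B :: "'a set" and Fs :: "('a \<times> 'a) set list"
  assumes "pair_graph G"
    and "zero_forcing_set G B"
    and "relaxed_chronology G B Fs"
  shows "zero_forcing_set G (terminus G Fs)
    \<and> relaxed_chronology G (terminus G Fs) (reversal Fs)
    \<and> prop_time G (terminus G Fs) (reversal Fs) = prop_time G B Fs"
proof -
  interpret chronology G B Fs
    using assms(1,3) by (intro chronology.intro chronology_axioms.intro)
  interpret rev: chronology G "terminus G Fs" "reversal Fs" by (rule chronology_reversal)
  \<comment> \<open>The opposite inequality is the same bound for the reversal, since reversing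
    twice restores both \<open>Fs\<close> and \<open>B\<close>.\<close>
  have "prop_time G B Fs \<le> prop_time G (terminus G Fs) (reversal Fs)"
    using rev.prop_time_reversal_le by (simp add: terminus_reversal reversal_reversal)
  then show ?thesis
    using rev.zero_forcing_set_initial relaxed_chronology_reversal prop_time_reversal_le by simp
qed

end
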